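(* Let $k\ge 0$, $\ell\ge 1$ be integers and let $f_1,\dots,f_\ell$ be functions from $\mathbb{Z}_{\ge 0}^k$ to $\mathbb{Z}_{\ge 0}$. Consider the identity $$\mathcal{G}(\mathrm{MCHN}(f_1,\dots,f_\ell,x_1,\dots,x_k,y_1,\dots,y_\ell))=\min(f_1(x_1,\dots,x_k),y_1)\oplus\cdots\oplus\min(f_\ell(x_1,\dots,x_k),y_\ell)\oplus x_1\oplus\cdots\oplus x_k.\qquad( * )$$ (1) If $f_1,\dots,f_\ell$ all satisfy the tasty condition, then $( * )$ holds for all $x_1,\dots,x_k,y_1,\dots,y_\ell\in\mathbb{Z}_{\ge 0}$. (2) If all $f_j$ are monotonous according to all dimensions, then $( * )$ holds for all $x_1,\dots,x_k,y_1,\dots,y_\ell\in\mathbb{Z}_{\ge 0}$ if and only if $f_1,\dots,f_\ell$ all satisfy the tasty condition.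
   Context: $\oplus$ denotes Nim-sum (bitwise XOR). For a position $G$ of an impartial game (finite play), the Sprague–Grundy value is $\mathcal{G}(G)=\mathrm{mex}\{\mathcal{G}(G') : G' \text{ an option of } G\}$, where $\mathrm{mex}(S)=\min(\mathbb{Z}_{\ge 0}\setminus S)$. Multiple Changing Head Nim: $\mathrm{MCHN}(f_1,\dots,f_\ell,x_1,\dots,x_k,y_1,\dots,y_\ell)$ consists of $k$ piles of sizes $x_1,\dots,x_k$ and $\ell$ further piles of sizes $\min(f_j(x_1,\dots,x_k),y_j)$, $1\le j\le\ell$, whose sizes may change when one plays on another pile. Its options are exactly: the positions obtained by replacing one $x_i$ by some $x_i'$ with $0\le x_i'<x_i$ (all other parameters, including all $y_j$, unchanged), and the positions obtained by replacing one $y_j$ by some $y_j'$ with $0\le y_j'<\min(f_j(x_1,\dots,x_k),y_j)$ (all other parameters unchanged). Tasty condition: $h:\mathbb{Z}_{\ge 0}^n\to\mathbb{Z}_{\ge 0}$ satisfies the tasty condition if for every coordinate index $c\in\{1,\dots,n\}$, all $z,z'\in\mathbb{Z}_{\ge 0}$ and every positive integer $i$ with $\lfloor z/2^i\rfloor=\lfloor z'/2^i\rfloor$, and all values of the other coordinates, $$\left\lfloor \frac{h(x_1,\dots,x_{c-1},z,x_{c+1},\dots,x_n)}{2^{i-1}}\right\rfloor=\left\lfloor \frac{h(x_1,\dots,x_{c-1},z',x_{c+1},\dots,x_n)}{2^{i-1}}\right\rfloor.$$ A function $f:\mathbb{Z}_{\ge 0}^k\to\mathbb{Z}_{\ge 0}$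 is monotonous according to all dimensions if for every $i\le k$ and all fixed values of the other coordinates, the one-variable function $z\mapsto f(x_1,\dots,x_{i-1},z,x_{i+1},\dots,x_k)$ is monotone (weakly increasing or weakly decreasing). *)

theory Defs
  imports Main
begin

unbundle bit_operations_syntax

definition mex :: "nat set \<Rightarrow> nat" where
  "mex S = (LEAST n. n \<notin> S)"

text \<open>An impartial game is given by the function \<open>opts\<close> that maps a position to the set of its
  options. The recursion is meaningful for games with finite play, that is, if the option relation is
  well-founded; \<open>grundy_unfold\<close> below recovers the defining equation.\<close>

definition option_rel :: "('p \<Rightarrow> 'p set) \<Rightarrow> ('p \<times> 'p) set" where
  "option_rel opts = {(q, p). q \<in> opts p}"

definition grundy :: "('p \<Rightarrow> 'p set) \<Rightarrow> 'p \<Rightarrow> nat" where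
  "grundy opts = wfrec (option_rel opts) (\<lambda>g p. mex (g ` opts p))"

lemma grundy_unfold:
  assumes "wf (option_rel opts)"
  shows "grundy opts p = mex (grundy opts ` opts p)"
proof -
  have "grundy opts p = mex (cut (grundy opts) (option_rel opts) p ` opts p)"
    unfolding grundy_def by (subst wfrec[OF assms]) (rule refl)
  also have "cut (grundy opts) (option_rel opts) p ` opts p = grundy opts ` opts p"
    by (rule image_cong) (auto simp: cut_def option_rel_def)
  finally show ?thesis .
qed

definition nim_sum :: "nat list \<Rightarrow> nat" where
  "nim_sum ns = foldr (XOR) ns 0"

text \<open>A tuple in \<open>\<nat>\<^sup>n\<close> is a list of length \<open>n\<close>, with coordinates indexed from \<open>0\<close>; a function on
  \<open>\<nat>\<^sup>n\<close> is a function on lists, of which only the values at lists of length \<open>n\<close> matter.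
  The position with parameters \<open>x\<^sub>1, \<dots>, x\<^sub>k\<close> and \<open>y\<^sub>1, \<dots>, y\<^sub>\<ell>\<close> is the pair \<open>(xs, ys)\<close>; it is
  the parameters \<open>y\<^sub>j\<close>, not the actual pile sizes \<open>min (f\<^sub>j(x\<^sub>1, \<dots>, x\<^sub>k)) y\<^sub>j\<close>, that are recorded.\<close>

definition mchn_opts ::
  "(nat list \<Rightarrow> nat) list \<Rightarrow> nat list \<times> nat list \<Rightarrow> (nat list \<times> nat list) set" where
  "mchn_opts fs = (\<lambda>(xs, ys).
     {(xs[i := x'], ys) | i x'. i < length xs \<and> x' < xs ! i} \<union>
     {(xs, ys[j := y']) | j y'. j < length ys \<and> y' < min ((fs ! j) xs) (ys ! j)})"

definition tasty :: "nat \<Rightarrow> (nat list \<Rightarrow> nat) \<Rightarrow> bool" where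
  "tasty n h \<longleftrightarrow>
     (\<forall>xs c z z' i. length xs = n \<and> c < n \<and> i > 0 \<and> z div 2 ^ i = z' div 2 ^ i \<longrightarrow>
        h (xs[c := z]) div 2 ^ (i - 1) = h (xs[c := z']) div 2 ^ (i - 1))"

definition monotonous :: "nat \<Rightarrow> (nat list \<Rightarrow> nat) \<Rightarrow> bool" where
  "monotonous k f \<longleftrightarrow>
     (\<forall>xs i. length xs = k \<and> i < k \<longrightarrow>
        mono (\<lambda>z. f (xs[i := z])) \<or> antimono (\<lambda>z. f (xs[i := z])))"

lemma sum_list_update_less:
  fixes x :: nat
  assumes "i < length xs" "x < xs ! i"
  shows "sum_list (xs[i := x]) < sum_list xs"
  using assms by (induction xs arbitrary: i) (auto split: nat.splits)

lemma wf_mchn: "wf (option_rel (mchn_opts fs))"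
proof (rule wf_subset)
  show "wf (measure (\<lambda>(xs, ys). sum_list xs + sum_list ys))"
    by (rule wf_measure)
  show "option_rel (mchn_opts fs) \<subseteq> measure (\<lambda>(xs, ys). sum_list xs + sum_list ys)"
    by (auto simp: option_rel_def mchn_opts_def sum_list_update_less)
qed

lemma finite_mchn_opts: "finite (mchn_opts fs p)"
proof (cases p)
  case (Pair xs ys)
  have "mchn_opts fs p \<subseteq>
      (\<Union>i<length xs. (\<lambda>x'. (xs[i := x'], ys)) ` {..<xs ! i}) \<union>
      (\<Union>j<length ys. (\<lambda>y'. (xs, ys[j := y'])) ` {..<ys ! j})"
    unfolding Pair mchn_opts_def by auto
  then show ?thesis
    by (rule finite_subset) simp
qed

end

theory Submission
  imports Defs
begin

text \<open>
  Everything happens along one coordinate. Write the nim-sum of a position as a function of a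
  single pile \<open>z\<close>, all other parameters being fixed: it has the form \<open>z XOR p z\<close>. The tasty
  condition says that the bits \<open>\<ge> e\<close> of \<open>p z\<close> are determined by the bits \<open>> e\<close> of \<open>z\<close>. It follows
  that the topmost bit at which \<open>z\<close> is changed is also changed in \<open>z XOR p z\<close>, so \<open>z \<mapsto> z XOR p z\<close> is
  injective (\<open>unary_tasty_inj\<close>), and that the bits of a prescribed value of \<open>z XOR p z\<close> can be
  fixed one after the other from the top down, so the map sends every dyadic block onto a
  dyadic block of the same size (\<open>unary_tasty_onto_block\<close>).

  Part (1) is then the classical argument for Nim. By injectivity no move keeps the nim-sum.
  To reach a smaller value \<open>m\<close>, take the topmost bit in which \<open>m\<close> and the nim-sum differ, and some
  pile that contains this bit. If the pile is a changing head it is reduced as in Nim; if it is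
  one of the \<open>x\<^sub>i\<close>, surjectivity onto the block below yields the new size.

  For the converse in part (2), the value formula forces \<open>z \<mapsto> z XOR min (g z) y\<close> to be injective
  for every \<open>y\<close> and every one-variable restriction \<open>g\<close> of every \<open>f\<^sub>j\<close> (the other heads are
  switched off by setting their parameters to \<open>0\<close>). One shows by induction on the cap \<open>c\<close>
  that \<open>min (g z) c\<close> is tasty. When the cap rises to \<open>c\<close> and \<open>2 ^ d\<close> is the largest power
  of two that divides \<open>c\<close>, the only possible obstruction is a block of size \<open>2 ^ (d + 1)\<close> that
  contains points with \<open>g z \<ge> c\<close> and points with \<open>g z < c\<close>. By monotonicity one half of this
  block lies entirely on one side. On this half \<open>z XOR min (g z) c\<close> runs through a whole block,
  by surjectivity for the cap \<open>c - 1\<close> or because it equals \<open>z XOR c\<close>, and this block contains a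
  value taken on the other side, which contradicts injectivity
  (\<open>superlevel_set_respects_blocks\<close>).
\<close>

section \<open>Dyadic blocks\<close>

lemma nat_xor_one: "(a::nat) XOR 1 = (if even a then a + 1 else a - 1)"
  using xor_one_eq[of a] by (simp del: One_nat_def)

lemma nat_xor_left_self: "(a::nat) XOR (a XOR b) = b"
  by (simp add: xor.assoc[symmetric])

lemma nat_xor_right_cancel: "(a::nat) XOR c = b XOR c \<longleftrightarrow> a = b"
  by (metis nat_xor_left_self xor.commute)

text \<open>Two numbers lie in the same dyadic block of size \<open>2 ^ e\<close> exactly if \<open>drop_bit e\<close> agrees
  on them.\<close>

lemma eq_xor_one_if_div_two_eq:
  fixes a b :: nat
  assumes "a div 2 = b div 2" and "a \<noteq> b"
  shows "a = b XOR 1"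
proof -
  have "a mod 2 \<noteq> b mod 2"
    using assms by (metis div_mult_mod_eq)
  then have "even a \<longleftrightarrow> odd b" by (metis even_iff_mod_2_eq_zero not_mod_2_eq_0_eq_1)
  then show ?thesis
    using assms(1) by (cases "even b") (auto simp: nat_xor_one simp del: One_nat_def elim!: evenE oddE)
qed

lemma topmost_differing_bit:
  fixes a b :: nat
  assumes "a \<noteq> b"
  obtains e where "drop_bit (Suc e) a = drop_bit (Suc e) b" "drop_bit e a = drop_bit e b XOR 1"
proof -
  let ?P = "\<lambda>n. drop_bit n a = drop_bit n b"
  have "?P (a + b)"
    by (simp add: drop_bit_eq_div)
      (metis add.commute add_lessD1 div_less less_add_same_cancel1 less_exp
        order.strict_trans1 le_add1 not_less)
  moreover have "\<not> ?P 0" using assms by simp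
  ultimately obtain e where e: "\<not> ?P e" "?P (Suc e)"
    using ex_least_nat_less[of ?P "a + b"] by blast
  have "drop_bit e a div 2 = drop_bit e b div 2"
    using e(2) by (simp add: drop_bit_eq_div div_mult2_eq[symmetric] mult.commute)
  with e show thesis
    by (intro that eq_xor_one_if_div_two_eq) auto
qed

lemma drop_bit_coarsen:
  fixes a b :: nat
  assumes "drop_bit e a = drop_bit e b" and "e \<le> d"
  shows "drop_bit d a = drop_bit d b"
  using assms by (metis drop_bit_drop_bit le_add_diff_inverse2)

lemma drop_bit_nat_mono: "a \<le> b \<Longrightarrow> drop_bit e a \<le> drop_bit e (b::nat)"
  by (simp add: drop_bit_eq_div div_le_mono)

lemma less_if_drop_bit_less: "drop_bit e a < drop_bit e b \<Longrightarrow> a < (b::nat)"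
  using drop_bit_nat_mono[of b a e] by (metis leD leI)

lemma drop_bit_min: "drop_bit e (min a b) = min (drop_bit e a) (drop_bit e (b::nat))"
  using drop_bit_nat_mono[of a b e] drop_bit_nat_mono[of b a e] by (auto simp: min_def)

lemma odd_xor_one_less: "odd (a::nat) \<Longrightarrow> a XOR 1 < a"
  by (auto simp: nat_xor_one simp del: One_nat_def elim!: oddE)

lemma drop_bit_flip: "drop_bit d (w XOR 2 ^ d) = drop_bit d (w::nat) XOR 1"
  by (simp only: drop_bit_xor) (simp add: drop_bit_eq_div del: One_nat_def)

lemma drop_bit_Suc_flip: "drop_bit (Suc d) (w XOR 2 ^ d) = drop_bit (Suc d) (w::nat)"
  by (simp only: drop_bit_xor) (simp add: drop_bit_eq_div)

lemma power_of_two_times_odd: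
  fixes c :: nat
  assumes "0 < c"
  obtains d u where "c = 2 ^ d * u" "odd u"
proof -
  have "\<exists>d u. c = 2 ^ d * u \<and> odd u"
    using assms
  proof (induction c rule: less_induct)
    case (less c)
    show ?case
    proof (cases "even c")
      case True
      then obtain b where b: "c = 2 * b" by (elim evenE)
      moreover have "b < c" "0 < b" using b less.prems by auto
      ultimately obtain d u where "b = 2 ^ d * u" "odd u" using less.IH by blast
      with b have "c = 2 ^ Suc d * u" by simp
      with \<open>odd u\<close> show ?thesis by blast
    qed (metis mult_1 power_0)
  qed
  with that show thesis by blast
qed

lemma drop_bit_pred_multiple:
  assumes "0 < u"
  shows "drop_bit d (2 ^ d * u - 1) = u - (1::nat)"
proof -
  obtain v where v: "u = Suc v" using assms by (cases u) auto
  have "(2 ^ d * Suc v - 1) div 2 ^ d = v"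
  proof (rule div_nat_eqI)
    have "(0::nat) < 2 ^ d" by simp
    then show "2 ^ d * v \<le> 2 ^ d * Suc v - 1" "2 ^ d * Suc v - 1 < 2 ^ d * Suc v"
      unfolding mult_Suc_right by linarith+
  qed
  then show ?thesis by (simp add: v drop_bit_eq_div)
qed

lemma drop_bit_pred:
  assumes "c = 2 ^ d * u" "odd u" "d < e"
  shows "drop_bit e (c - 1) = drop_bit e (c::nat)"
proof -
  have "drop_bit (Suc d) (c - 1) = (u - 1) div 2"
    using drop_bit_pred_multiple[of u d] assms(1,2)
    by (simp add: drop_bit_eq_div odd_pos div_mult2_eq mult.commute[of 2])
  also have "\<dots> = u div 2" using assms(2) by (auto elim!: oddE)
  also have "\<dots> = drop_bit (Suc d) c" by (simp add: assms(1) drop_bit_eq_div)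
  finally show ?thesis
    using Suc_leI[OF assms(3)] by (rule drop_bit_coarsen)
qed

section \<open>Tasty functions of one variable\<close>

definition unary_tasty :: "(nat \<Rightarrow> nat) \<Rightarrow> bool" where
  "unary_tasty p \<longleftrightarrow>
     (\<forall>z z' e. drop_bit (Suc e) z = drop_bit (Suc e) z' \<longrightarrow> drop_bit e (p z) = drop_bit e (p z'))"

lemma unary_tastyD:
  "unary_tasty p \<Longrightarrow> drop_bit (Suc e) z = drop_bit (Suc e) z' \<Longrightarrow>
   drop_bit e (p z) = drop_bit e (p z')"
  unfolding unary_tasty_def by blast

lemma tasty_iff_unary:
  "tasty n h \<longleftrightarrow> (\<forall>xs c. length xs = n \<and> c < n \<longrightarrow> unary_tasty (\<lambda>z. h (xs[c := z])))"
  (is "?L \<longleftrightarrow> ?R")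
proof
  assume L: ?L
  have "drop_bit e (h (xs[c := z])) = drop_bit e (h (xs[c := z']))"
    if "length xs = n" "c < n" "drop_bit (Suc e) z = drop_bit (Suc e) z'" for xs c z z' e
  proof -
    have "z div 2 ^ Suc e = z' div 2 ^ Suc e"
      using that(3) by (simp only: drop_bit_eq_div)
    with that(1,2) have "h (xs[c := z]) div 2 ^ (Suc e - 1) = h (xs[c := z']) div 2 ^ (Suc e - 1)"
      by (intro L[unfolded tasty_def, rule_format, of xs c "Suc e" z z'] conjI zero_less_Suc)
    then show ?thesis
      by (simp only: drop_bit_eq_div diff_Suc_1)
  qed
  then show ?R
    unfolding unary_tasty_def by blast
next
  assume R: ?R
  have "h (xs[c := z]) div 2 ^ e = h (xs[c := z']) div 2 ^ e"
    if "length xs = n" "c < n" "z div 2 ^ Suc e = z' div 2 ^ Suc e" for xs c z z' e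
    using unary_tastyD[of "\<lambda>z. h (xs[c := z])" e z z'] R that
    unfolding drop_bit_eq_div by blast
  then show ?L
    unfolding tasty_def by (metis Suc_pred')
qed

lemma unary_tasty_const: "unary_tasty (\<lambda>z. a)"
  by (simp add: unary_tasty_def)

lemma unary_tasty_xor: "unary_tasty p \<Longrightarrow> unary_tasty q \<Longrightarrow> unary_tasty (\<lambda>z. p z XOR q z)"
  unfolding unary_tasty_def drop_bit_xor by (intro allI impI arg_cong2[where f = "(XOR)"]) blast+

lemma unary_tasty_min: "unary_tasty p \<Longrightarrow> unary_tasty (\<lambda>z. min (p z) y)"
  unfolding unary_tasty_def drop_bit_min by (intro allI impI arg_cong2[where f = min]) blast+

text \<open>At the topmost bit where \<open>z\<close> and \<open>z'\<close> differ, \<open>p z\<close> and \<open>p z'\<close> still agree, so this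
  difference survives in the nim-sum.\<close>

lemma unary_tasty_inj:
  assumes "unary_tasty p"
  shows "inj (\<lambda>z. z XOR p z)"
proof (rule injI, rule ccontr)
  fix z z' :: nat
  assume eq: "z XOR p z = z' XOR p z'" and "z \<noteq> z'"
  then obtain e where e: "drop_bit (Suc e) z = drop_bit (Suc e) z'"
      "drop_bit e z = drop_bit e z' XOR 1"
    using topmost_differing_bit by metis
  have "drop_bit e z XOR drop_bit e (p z) = drop_bit e z' XOR drop_bit e (p z')"
    using arg_cong[OF eq, of "drop_bit e"] by (simp add: drop_bit_xor)
  then have "drop_bit e z = drop_bit e z'"
    using unary_tastyD[OF assms e(1)] by (simp add: nat_xor_right_cancel)
  with e(2) show False by (cases "even (drop_bit e z')") (auto simp: nat_xor_one simp del: One_nat_def elim!: oddE)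
qed

text \<open>If the two values agree down to bit \<open>e + 1\<close> but not at bit \<open>e\<close>, flipping bit \<open>e\<close> of \<open>w\<close>
  leaves the bits \<open>\<ge> e\<close> of \<open>p w\<close> alone and therefore corrects exactly bit \<open>e\<close> of the nim-sum.\<close>

lemma unary_tasty_onto_block:
  assumes "unary_tasty p" and "drop_bit e m = drop_bit e (w XOR p w)"
  shows "\<exists>z. drop_bit e z = drop_bit e w \<and> z XOR p z = m"
  using assms(2)
proof (induction e arbitrary: w)
  case 0
  then show ?case by auto
next
  case (Suc e)
  show ?case
  proof (cases "drop_bit e m = drop_bit e (w XOR p w)")
    case True
    from Suc.IH[OF this] show ?thesis
      by (metis drop_bit_coarsen le_SucI le_refl)
  next
    case False
    have "drop_bit e m div 2 = drop_bit e (w XOR p w) div 2"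
      using Suc.prems by (simp add: drop_bit_eq_div div_mult2_eq[symmetric] mult.commute)
    then have m: "drop_bit e m = drop_bit e (w XOR p w) XOR 1"
      using False eq_xor_one_if_div_two_eq by blast
    define w' where "w' = w XOR 2 ^ e"
    have w': "drop_bit (Suc e) w' = drop_bit (Suc e) w"
      unfolding w'_def by (rule drop_bit_Suc_flip)
    have "drop_bit e (w' XOR p w') = drop_bit e w XOR 1 XOR drop_bit e (p w)"
      using unary_tastyD[OF assms(1) w'] drop_bit_flip[of e w, folded w'_def]
      by (simp add: xor.assoc)
    also have "\<dots> = drop_bit e m"
      by (simp add: m drop_bit_xor ac_simps)
    finally obtain z where "drop_bit e z = drop_bit e w'" "z XOR p z = m"
      using Suc.IH[of w'] by metis
    then show ?thesis
      using w' by (metis drop_bit_coarsen le_SucI le_refl)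
  qed
qed

section \<open>Monotone functions with injective capped nim-sums are tasty\<close>

text \<open>The heart of the converse. Inside a block on which the superlevel set of \<open>c\<close> is mixed, a half
  that lies on one side of the level \<open>c\<close> collides with any point of the other half on the opposite
  side, because \<open>c\<close> and \<open>c - 1\<close> differ exactly by \<open>1\<close> after dropping \<open>d\<close> bits, just as the
  two halves do.\<close>

lemma superlevel_set_respects_blocks:
  fixes g :: "nat \<Rightarrow> nat"
  assumes mono: "mono g \<or> antimono g"
    and inj: "inj (\<lambda>z. z XOR min (g z) c)"
    and tasty: "unary_tasty (\<lambda>z. min (g z) (c - 1))"
    and c: "c = 2 ^ d * u" "odd u"
    and block: "drop_bit (Suc d) w = drop_bit (Suc d) w'"
    and mixed: "c \<le> g w" "g w' < c"
  shows False
proof -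
  define q where "q z = min (g z) (c - 1)" for z
  have p_above: "min (g z) c = c" if "c \<le> g z" for z using that by simp
  have p_below: "min (g z) c = q z" if "g z < c" for z using that by (simp add: q_def)
  have drop_c: "drop_bit d c = u" by (simp add: c(1) drop_bit_eq_div)
  have "drop_bit d (c - 1) = u - 1"
    using drop_bit_pred_multiple[OF odd_pos[OF c(2)], of d] by (simp only: c(1))
  also have "\<dots> = u XOR 1" using c(2) by (auto simp: nat_xor_one simp del: One_nat_def elim!: oddE)
  finally have drop_c1: "drop_bit d (c - 1) = u XOR 1" .
  \<comment> \<open>On the whole block the old cap is reached up to the last \<open>d\<close> bits, as it is reached at \<open>w\<close>.\<close>
  have drop_q: "drop_bit d (q z) = u XOR 1" if "drop_bit (Suc d) z = drop_bit (Suc d) w" for z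
  proof -
    have "drop_bit d (q z) = drop_bit d (q w)"
      using unary_tastyD[OF tasty that] by (simp add: q_def)
    also have "q w = c - 1" using mixed(1) by (simp add: q_def)
    finally show ?thesis by (simp only: drop_c1)
  qed
  \<comment> \<open>So the half without \<open>w'\<close> cannot lie entirely above the level \<open>c\<close> ...\<close>
  have not_above: "\<exists>z. drop_bit d z = drop_bit d w' XOR 1 \<and> g z < c"
  proof (rule ccontr)
    assume none: "\<not> ?thesis"
    \<comment> \<open>The only point that can collide with \<open>w'\<close> from above the level.\<close>
    define z where "z = c XOR w' XOR q w'"
    have "drop_bit d z = drop_bit d w' XOR 1"
      unfolding z_def
      by (simp add: drop_bit_xor drop_c drop_q[OF block[symmetric]] ac_simps nat_xor_left_self)
    with none have "c \<le> g z" by auto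
    then have "z XOR min (g z) c = w' XOR min (g w') c"
      unfolding p_above[OF \<open>c \<le> g z\<close>] p_below[OF mixed(2)] z_def
      by (simp add: ac_simps nat_xor_left_self)
    with inj have "z = w'" by (meson injD)
    with \<open>c \<le> g z\<close> mixed show False by simp
  qed
  \<comment> \<open>... and the half without \<open>w\<close> cannot lie entirely below it.\<close>
  have not_below: "\<exists>z. drop_bit d z = drop_bit d w XOR 1 \<and> c \<le> g z"
  proof (rule ccontr)
    assume none: "\<not> ?thesis"
    define v where "v = w XOR 2 ^ d"
    have v: "drop_bit d v = drop_bit d w XOR 1" "drop_bit (Suc d) v = drop_bit (Suc d) w"
      unfolding v_def by (rule drop_bit_flip drop_bit_Suc_flip)+
    have "drop_bit d (c XOR w) = drop_bit d (v XOR q v)"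
      by (simp add: drop_bit_xor drop_c drop_q[OF v(2)] v(1) ac_simps nat_xor_left_self)
    then obtain z where z: "drop_bit d z = drop_bit d v" "z XOR q z = c XOR w"
      using unary_tasty_onto_block[OF tasty, of d "c XOR w" v] by (auto simp: q_def)
    have "g z < c" using none z(1) v(1) by (metis not_less)
    then have "z XOR min (g z) c = w XOR min (g w) c"
      unfolding p_above[OF mixed(1)] p_below[OF \<open>g z < c\<close>] z(2) by (simp add: xor.commute)
    with inj have "z = w" by (meson injD)
    with \<open>g z < c\<close> mixed show False by simp
  qed
  obtain a b where a: "drop_bit d a = drop_bit d w' XOR 1" "g a < c"
    and b: "drop_bit d b = drop_bit d w XOR 1" "c \<le> g b"
    using not_above not_below by blast
  \<comment> \<open>Hence each half contains points on both sides, so the order of two such points can be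
    chosen against the direction of monotonicity.\<close>
  have order: "x < y" if "drop_bit d x < drop_bit d y" for x y :: nat
    using that by (rule less_if_drop_bit_less)
  have flip: "x XOR 1 < x \<or> x < x XOR 1" for x :: nat
    by (cases "even x") (auto simp: nat_xor_one simp del: One_nat_def elim!: evenE oddE)
  have halves: "drop_bit d w = drop_bit d w' \<or> drop_bit d w = drop_bit d w' XOR 1"
  proof -
    have "drop_bit d w div 2 = drop_bit d w' div 2"
      using block by (simp add: drop_bit_eq_div div_mult2_eq[symmetric] mult.commute)
    then show ?thesis using eq_xor_one_if_div_two_eq by blast
  qed
  have "\<exists>x y x' y'. c \<le> g x \<and> g y < c \<and> c \<le> g x' \<and> g y' < c \<and> x < y \<and> y' < x'"
    using halves
  proof
    assume *: "drop_bit d w = drop_bit d w'"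
    then have "w < a \<and> w' < b \<or> a < w \<and> b < w'"
      using a b flip[of "drop_bit d w'"] order by metis
    then show ?thesis using a b mixed by blast
  next
    assume *: "drop_bit d w = drop_bit d w' XOR 1"
    then have "drop_bit d b = drop_bit d w'" using b(1) by (simp add: xor.assoc)
    then have "w < w' \<and> a < b \<or> w' < w \<and> b < a"
      using * a b flip[of "drop_bit d w'"] order by metis
    then show ?thesis using a b mixed by blast
  qed
  then obtain x y x' y' where above: "c \<le> g x" "c \<le> g x'" and below: "g y < c" "g y' < c"
    and "x < y" "y' < x'"
    by blast
  from mono show False
  proof
    assume "mono g"
    then have "g x \<le> g y" using \<open>x < y\<close> by (simp add: monoD)
    with above below show False by simp
  next
    assume "antimono g"
    then have "g x' \<le> g y'" using \<open>y' < x'\<close> by (simp add: antimonoD)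
    with above below show False by simp
  qed
qed

text \<open>Raising the cap by one can only spoil the tasty condition for blocks in which \<open>g\<close> crosses the
  new cap. Bits above the lowest set bit of the new cap do not notice the change, and for the
  other bits the relevant blocks are not crossed, by \<open>superlevel_set_respects_blocks\<close>.\<close>

lemma unary_tasty_if_caps_inj:
  fixes g :: "nat \<Rightarrow> nat"
  assumes mono: "mono g \<or> antimono g"
    and inj: "\<And>y. inj (\<lambda>z. z XOR min (g z) y)"
  shows "unary_tasty g"
proof -
  have capped: "unary_tasty (\<lambda>z. min (g z) c)" for c
  proof (induction c)
    case 0
    show ?case by (simp add: unary_tasty_const)
  next
    case (Suc c)
    obtain d u where du: "Suc c = 2 ^ d * u" "odd u"
      using power_of_two_times_odd[of "Suc c"] by blast
    show ?case
      unfolding unary_tasty_def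
    proof (intro allI impI)
      fix z z' e :: nat
      assume zz: "drop_bit (Suc e) z = drop_bit (Suc e) z'"
      have old: "drop_bit e (min (g z) c) = drop_bit e (min (g z') c)"
        using unary_tastyD[OF Suc zz] .
      show "drop_bit e (min (g z) (Suc c)) = drop_bit e (min (g z') (Suc c))"
      proof (cases "d < e")
        case True
        \<comment> \<open>Passing from \<open>c\<close> to \<open>Suc c\<close> changes no bit above bit \<open>d\<close>.\<close>
        then have "drop_bit e (Suc c) = drop_bit e c"
          using drop_bit_pred[OF du] by simp
        with old show ?thesis by (simp add: drop_bit_min)
      next
        case False
        then have "drop_bit (Suc d) z = drop_bit (Suc d) z'"
          by (intro drop_bit_coarsen[OF zz]) simp
        then have "Suc c \<le> g z \<longleftrightarrow> Suc c \<le> g z'"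
          using superlevel_set_respects_blocks[OF mono inj _ du, of z z']
            superlevel_set_respects_blocks[OF mono inj _ du, of z' z] Suc by (metis diff_Suc_1 not_less)
        then show ?thesis
          using old by (cases "Suc c \<le> g z") (auto simp: min_def)
      qed
    qed
  qed
  show ?thesis
    unfolding unary_tasty_def
  proof (intro allI impI)
    fix z z' e :: nat
    assume "drop_bit (Suc e) z = drop_bit (Suc e) z'"
    from unary_tastyD[OF capped[of "max (g z) (g z')"] this]
    show "drop_bit e (g z) = drop_bit e (g z')" by simp
  qed
qed

section \<open>Nim-sums and minimal excludants\<close>

lemma nim_sum_Nil [simp]: "nim_sum [] = 0"
  and nim_sum_Cons [simp]: "nim_sum (n # ns) = n XOR nim_sum ns"
  by (simp_all add: nim_sum_def)

lemma nim_sum_append: "nim_sum (ms @ ns) = nim_sum ms XOR nim_sum ns"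
  by (induction ms) (simp_all add: xor.assoc)

lemma nim_sum_update:
  "i < length ns \<Longrightarrow> nim_sum (ns[i := v]) = v XOR nim_sum (ns[i := 0])"
  by (induction ns arbitrary: i) (auto split: nat.splits simp: xor.left_commute)

lemma nim_sum_replicate_zero [simp]: "nim_sum (replicate n 0) = 0"
  by (induction n) simp_all

lemma odd_drop_bit_nim_sum:
  assumes "odd (drop_bit d (nim_sum ns))"
  obtains i where "i < length ns" "odd (drop_bit d (ns ! i))"
proof -
  have "odd (drop_bit d (nim_sum ns)) \<Longrightarrow> \<exists>n\<in>set ns. odd (drop_bit d n)"
    by (induction ns) (auto simp: drop_bit_xor even_xor_iff)
  with assms that show thesis by (metis in_set_conv_nth)
qed

lemma mex_eqI: "n \<notin> S \<Longrightarrow> (\<And>m. m < n \<Longrightarrow> m \<in> S) \<Longrightarrow> mex S = n"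
  unfolding mex_def by (rule Least_equality) (auto simp: not_less[symmetric])

lemma mex_notin: "finite S \<Longrightarrow> mex S \<notin> S"
  unfolding mex_def by (rule LeastI_ex) (metis ex_new_if_finite infinite_UNIV_nat)

section \<open>The value of a position\<close>

definition mchn_heads :: "(nat list \<Rightarrow> nat) list \<Rightarrow> nat list \<Rightarrow> nat list \<Rightarrow> nat list" where
  "mchn_heads fs xs ys = map2 (\<lambda>f y. min (f xs) y) fs ys"

definition mchn_value :: "(nat list \<Rightarrow> nat) list \<Rightarrow> nat list \<times> nat list \<Rightarrow> nat" where
  "mchn_value fs = (\<lambda>(xs, ys). nim_sum (mchn_heads fs xs ys @ xs))"

lemma length_mchn_heads [simp]: "length (mchn_heads fs xs ys) = min (length fs) (length ys)"
  by (simp add: mchn_heads_def)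

lemma mchn_heads_update:
  assumes "j < length ys" "length fs = length ys"
  shows "mchn_heads fs xs (ys[j := y]) = (mchn_heads fs xs ys)[j := min ((fs ! j) xs) y]"
  using assms by (auto simp: mchn_heads_def list_eq_iff_nth_eq nth_list_update)

lemma mchn_value_head_update:
  assumes "j < length ys" "length fs = length ys"
  shows "mchn_value fs (xs, ys[j := y]) =
    min ((fs ! j) xs) y XOR nim_sum ((mchn_heads fs xs ys)[j := 0]) XOR nim_sum xs"
  using assms nim_sum_update[of j "mchn_heads fs xs ys" "min ((fs ! j) xs) y"]
  by (simp add: mchn_value_def mchn_heads_update nim_sum_append xor.assoc)

lemma mchn_value_pile_update:
  assumes "i < length xs"
  shows "mchn_value fs (xs[i := z], ys) =
    z XOR (nim_sum (mchn_heads fs (xs[i := z]) ys) XOR nim_sum (xs[i := 0]))"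
  using assms nim_sum_update[of i xs z]
  by (simp add: mchn_value_def nim_sum_append xor.left_commute)

lemma unary_tasty_heads:
  assumes "\<forall>f\<in>set fs. unary_tasty (\<lambda>z. f (xs[i := z]))"
  shows "unary_tasty (\<lambda>z. nim_sum (mchn_heads fs (xs[i := z]) ys))"
  using assms
proof (induction fs arbitrary: ys)
  case Nil
  show ?case by (simp add: mchn_heads_def unary_tasty_const)
next
  case (Cons f fs)
  then show ?case
    by (cases ys)
      (auto simp: mchn_heads_def unary_tasty_const intro!: unary_tasty_xor unary_tasty_min)
qed

lemma mchn_opts_cases:
  assumes "q \<in> mchn_opts fs (xs, ys)"
  obtains (pile) i x' where "i < length xs" "x' < xs ! i" "q = (xs[i := x'], ys)"
  | (head) j y' where "j < length ys" "y' < min ((fs ! j) xs) (ys ! j)" "q = (xs, ys[j := y'])"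
  using assms unfolding mchn_opts_def by auto

lemma mchn_option_value_neq:
  assumes tasty: "\<forall>f\<in>set fs. tasty (length xs) f" and len: "length fs = length ys"
    and opt: "q \<in> mchn_opts fs (xs, ys)"
  shows "mchn_value fs q \<noteq> mchn_value fs (xs, ys)"
  using opt
proof (cases rule: mchn_opts_cases)
  case (pile i x')
  define p where "p z = nim_sum (mchn_heads fs (xs[i := z]) ys) XOR nim_sum (xs[i := 0])" for z
  have "unary_tasty p"
    unfolding p_def using tasty pile(1)
    by (intro unary_tasty_xor unary_tasty_const unary_tasty_heads) (auto simp: tasty_iff_unary)
  then have "x' XOR p x' \<noteq> xs ! i XOR p (xs ! i)"
    using pile(2) unary_tasty_inj[of p] by (metis injD less_irrefl)
  then show ?thesis
    using pile mchn_value_pile_update[OF pile(1), of fs x' ys]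
      mchn_value_pile_update[OF pile(1), of fs "xs ! i" ys] by (simp add: p_def)
next
  case (head j y')
  have "mchn_value fs (xs, ys) =
      min ((fs ! j) xs) (ys ! j) XOR (nim_sum ((mchn_heads fs xs ys)[j := 0]) XOR nim_sum xs)"
    using mchn_value_head_update[OF head(1) len, of xs "ys ! j"] by simp
  moreover have "mchn_value fs q =
      y' XOR (nim_sum ((mchn_heads fs xs ys)[j := 0]) XOR nim_sum xs)"
    using mchn_value_head_update[OF head(1) len, of xs y'] head(2,3) by (simp add: min_absorb2)
  ultimately show ?thesis
    using head(2) by (metis nat_xor_right_cancel less_irrefl)
qed

lemma mchn_option_value_reach:
  assumes tasty: "\<forall>f\<in>set fs. tasty (length xs) f" and len: "length fs = length ys"
    and m: "m < mchn_value fs (xs, ys)"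
  shows "m \<in> mchn_value fs ` mchn_opts fs (xs, ys)"
proof -
  define N where "N = mchn_value fs (xs, ys)"
  obtain d where d: "drop_bit (Suc d) m = drop_bit (Suc d) N" "drop_bit d m = drop_bit d N XOR 1"
    using m topmost_differing_bit[of m N] by (metis N_def less_irrefl)
  have odd_N: "odd (drop_bit d N)"
  proof (rule ccontr)
    assume "\<not> ?thesis"
    then have "drop_bit d N < drop_bit d m" by (simp add: d(2) nat_xor_one del: One_nat_def)
    then have "N < m" by (rule less_if_drop_bit_less)
    with m show False by (simp add: N_def)
  qed
  then obtain i where i: "i < length (mchn_heads fs xs ys @ xs)"
    "odd (drop_bit d ((mchn_heads fs xs ys @ xs) ! i))"
    unfolding N_def mchn_value_def by (auto elim: odd_drop_bit_nim_sum)
  show ?thesis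
  proof (cases "i < length ys")
    case True
    \<comment> \<open>A changing head contains the bit: the move is the one of ordinary Nim.\<close>
    define v where "v = min ((fs ! i) xs) (ys ! i)"
    define v' where "v' = v XOR N XOR m"
    have v: "odd (drop_bit d v)"
      using i True len by (simp add: nth_append mchn_heads_def v_def)
    have "drop_bit d v' = drop_bit d v XOR 1"
      by (simp add: v'_def drop_bit_xor d(2) ac_simps nat_xor_left_self)
    then have less: "v' < v"
      using odd_xor_one_less[OF v] less_if_drop_bit_less[of d v' v] by argo
    have "N = v XOR nim_sum ((mchn_heads fs xs ys)[i := 0]) XOR nim_sum xs"
      using mchn_value_head_update[OF True len, of xs "ys ! i"] by (simp add: N_def v_def)
    moreover have "mchn_value fs (xs, ys[i := v']) =
        v' XOR nim_sum ((mchn_heads fs xs ys)[i := 0]) XOR nim_sum xs"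
      using less mchn_value_head_update[OF True len, of xs v'] by (simp add: v_def min_absorb2)
    ultimately have "mchn_value fs (xs, ys[i := v']) = m"
      by (simp add: v'_def ac_simps nat_xor_left_self)
    moreover have "(xs, ys[i := v']) \<in> mchn_opts fs (xs, ys)"
      using True less by (auto simp: mchn_opts_def v_def)
    ultimately show ?thesis by (metis imageI)
  next
    case False
    define c where "c = i - length ys"
    have c: "c < length xs" "odd (drop_bit d (xs ! c))"
      using i False len by (auto simp: c_def nth_append)
    define p where "p z = nim_sum (mchn_heads fs (xs[c := z]) ys) XOR nim_sum (xs[c := 0])" for z
    have p: "unary_tasty p"
      unfolding p_def using tasty c(1)
      by (intro unary_tasty_xor unary_tasty_const unary_tasty_heads) (auto simp: tasty_iff_unary)
    have option_value: "mchn_value fs (xs[c := z], ys) = z XOR p z" for z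
      unfolding p_def by (rule mchn_value_pile_update[OF c(1)])
    have N: "N = xs ! c XOR p (xs ! c)"
      using option_value[of "xs ! c"] by (simp add: N_def)
    \<comment> \<open>The block just below the one of \<open>xs ! c\<close> is mapped onto the block of \<open>m\<close>.\<close>
    define w where "w = xs ! c XOR 2 ^ d"
    have w: "drop_bit d w = drop_bit d (xs ! c) XOR 1" "drop_bit (Suc d) w = drop_bit (Suc d) (xs ! c)"
      unfolding w_def by (rule drop_bit_flip drop_bit_Suc_flip)+
    have "drop_bit d m = drop_bit d (w XOR p w)"
      by (simp add: d(2) N drop_bit_xor w(1) unary_tastyD[OF p w(2)] ac_simps)
    then obtain z where z: "drop_bit d z = drop_bit d w" "z XOR p z = m"
      using unary_tasty_onto_block[OF p] by blast
    have "z < xs ! c"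
      using odd_xor_one_less[OF c(2)] z(1) w(1) less_if_drop_bit_less[of d z "xs ! c"] by argo
    then have "(xs[c := z], ys) \<in> mchn_opts fs (xs, ys)"
      using c(1) by (auto simp: mchn_opts_def)
    then show ?thesis using option_value[of z] z(2) by (metis imageI)
  qed
qed

lemma grundy_mchn_if_tasty:
  assumes tasty: "\<forall>f\<in>set fs. tasty k f"
    and "length (fst pos) = k" and "length (snd pos) = length fs"
  shows "grundy (mchn_opts fs) pos = mchn_value fs pos"
  using wf_mchn[of fs] assms(2,3)
proof (induction pos rule: wf_induct_rule)
  case (less pos)
  obtain xs ys where pos: "pos = (xs, ys)" by (cases pos)
  have "grundy (mchn_opts fs) ` mchn_opts fs pos = mchn_value fs ` mchn_opts fs pos"
  proof (rule image_cong)
    fix q assume q: "q \<in> mchn_opts fs pos"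
    then have "length (fst q) = k" "length (snd q) = length fs"
      using less.prems by (auto simp: pos elim!: mchn_opts_cases)
    with q show "grundy (mchn_opts fs) q = mchn_value fs q"
      by (intro less.IH) (auto simp: option_rel_def)
  qed simp
  moreover have "mex (mchn_value fs ` mchn_opts fs pos) = mchn_value fs pos"
    unfolding pos
  proof (rule mex_eqI)
    have len: "\<forall>f\<in>set fs. tasty (length xs) f" "length fs = length ys"
      using tasty less.prems by (auto simp: pos)
    show "mchn_value fs (xs, ys) \<notin> mchn_value fs ` mchn_opts fs (xs, ys)"
      using mchn_option_value_neq[OF len] by fastforce
    show "m \<in> mchn_value fs ` mchn_opts fs (xs, ys)" if "m < mchn_value fs (xs, ys)" for m
      using mchn_option_value_reach[OF len that] .
  qed
  ultimately show ?case
    by (simp add: grundy_unfold[OF wf_mchn, of fs pos])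
qed

section \<open>Necessity of the tasty condition\<close>

lemma grundy_option_neq:
  assumes "q \<in> mchn_opts fs pos"
  shows "grundy (mchn_opts fs) q \<noteq> grundy (mchn_opts fs) pos"
  using assms mex_notin[of "grundy (mchn_opts fs) ` mchn_opts fs pos"] finite_mchn_opts[of fs pos]
  by (metis finite_imageI grundy_unfold[OF wf_mchn] imageI)

text \<open>Setting all other head parameters to \<open>0\<close> isolates the head under consideration; the unchanged
  piles contribute the same summand on both sides.\<close>

lemma capped_inj_if_grundy_eq_value:
  assumes val: "\<And>xs ys. length xs = k \<Longrightarrow> length ys = length fs \<Longrightarrow>
      grundy (mchn_opts fs) (xs, ys) = mchn_value fs (xs, ys)"
    and j: "j < length fs" and i: "length xs = k" "i < k"
  shows "inj (\<lambda>z. z XOR min ((fs ! j) (xs[i := z])) y)"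
proof -
  define ys where "ys = (replicate (length fs) 0)[j := y]"
  have heads: "nim_sum (mchn_heads fs xs' ys) = min ((fs ! j) xs') y" for xs'
  proof -
    have "mchn_heads fs xs' (replicate (length fs) 0) = replicate (length fs) 0"
      by (auto simp: mchn_heads_def list_eq_iff_nth_eq)
    then show ?thesis
      using j nim_sum_update[of j "replicate (length fs) 0" "min ((fs ! j) xs') y"]
        list_update_id[of "replicate (length fs) (0::nat)" j]
      by (simp add: ys_def mchn_heads_update)
  qed
  have neq: "z XOR min ((fs ! j) (xs[i := z])) y \<noteq> z' XOR min ((fs ! j) (xs[i := z'])) y"
    if "z < z'" for z z'
  proof -
    have "(xs[i := z], ys) \<in> mchn_opts fs (xs[i := z'], ys)"
      using that i by (fastforce simp: mchn_opts_def)
    from grundy_option_neq[OF this]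
    have "mchn_value fs (xs[i := z], ys) \<noteq> mchn_value fs (xs[i := z'], ys)"
      using i by (simp add: val ys_def)
    then show ?thesis
      using i by (simp add: mchn_value_pile_update heads xor.assoc[symmetric] nat_xor_right_cancel)
  qed
  show ?thesis
    by (rule injI) (metis neq linorder_neqE_nat)
qed

theorem theorem18:
  fixes k l :: nat and fs :: "(nat list \<Rightarrow> nat) list"
  assumes "l \<ge> 1" and "length fs = l"
  shows
    "((\<forall>f\<in>set fs. tasty k f) \<longrightarrow>
        (\<forall>xs ys. length xs = k \<and> length ys = l \<longrightarrow>
           grundy (mchn_opts fs) (xs, ys) =
             nim_sum (map2 (\<lambda>f y. min (f xs) y) fs ys @ xs))) \<and>
     ((\<forall>f\<in>set fs. monotonous k f) \<longrightarrow>
        ((\<forall>xs ys. length xs = k \<and> length ys = l \<longrightarrow>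
            grundy (mchn_opts fs) (xs, ys) =
              nim_sum (map2 (\<lambda>f y. min (f xs) y) fs ys @ xs)) \<longleftrightarrow>
         (\<forall>f\<in>set fs. tasty k f)))"
proof -
  have formula: "nim_sum (map2 (\<lambda>f y. min (f xs) y) fs ys @ xs) = mchn_value fs (xs, ys)" for xs ys
    by (simp add: mchn_value_def mchn_heads_def)
  have sufficient: "grundy (mchn_opts fs) (xs, ys) = mchn_value fs (xs, ys)"
    if "\<forall>f\<in>set fs. tasty k f" "length xs = k" "length ys = l" for xs ys
    using that assms(2) by (intro grundy_mchn_if_tasty) auto
  have necessary: "tasty k f"
    if mono: "\<forall>f\<in>set fs. monotonous k f"
      and val: "\<forall>xs ys. length xs = k \<and> length ys = l \<longrightarrow>
        grundy (mchn_opts fs) (xs, ys) = mchn_value fs (xs, ys)"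
      and f: "f \<in> set fs" for f
  proof -
    obtain j where j: "j < length fs" "f = fs ! j"
      using f by (metis in_set_conv_nth)
    show ?thesis
      unfolding tasty_iff_unary
    proof (intro allI impI)
      fix xs :: "nat list" and i
      assume "length xs = k \<and> i < k"
      then show "unary_tasty (\<lambda>z. f (xs[i := z]))"
        using mono f val assms(2) unfolding j(2)
        by (intro unary_tasty_if_caps_inj capped_inj_if_grundy_eq_value[OF _ j(1)])
          (auto simp: monotonous_def)
    qed
  qed
  show ?thesis
    unfolding formula using sufficient necessary by blast
qed

end
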